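(* Let $X$ be a reflexive Banach space with a finite-dimensional decomposition (FDD). Then $X$ satisfies the UALS property if and only if $X^*$ does.
   Context: A Banach space $E$ satisfies the UALS property if there exists $C>0$ such that for every convex norm-compact $W\subset\mathcal{L}(E)$ (bounded operators with operator norm), every $A\in\mathcal{L}(E)$ and $\varepsilon>0$ such that for every $x$ in the unit ball of $E$ there is $B\in W$ with $\|A(x)-B(x)\|\le\varepsilon$, there exist a closed finite-codimensional subspace $Y$ of $E$ and $B\in W$ with $\|(A-B)|_Y\|_{\mathcal{L}(Y,E)}\le C\varepsilon$. *)

theory Defs
  imports "HOL-Analysis.Analysis"
begin

definition reflexive_space :: "'a::banach itself \<Rightarrow> bool" where
  "reflexive_space _ \<longleftrightarrow>
     (\<forall>\<phi> :: ('a \<Rightarrow>\<^sub>L real) \<Rightarrow>\<^sub>L real. \<exists>x::'a. \<forall>f. blinfun_apply \<phi> f = blinfun_apply f x)"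

definition finite_dim_set :: "'a::real_vector set \<Rightarrow> bool" where
  "finite_dim_set S \<longleftrightarrow> (\<exists>B. finite B \<and> S \<subseteq> span B)"

definition has_FDD :: "'a::banach itself \<Rightarrow> bool" where
  "has_FDD _ \<longleftrightarrow>
     (\<exists>E :: nat \<Rightarrow> 'a set. (\<forall>n. subspace (E n) \<and> finite_dim_set (E n)) \<and>
        (\<forall>x. \<exists>!u::nat \<Rightarrow> 'a. (\<forall>n. u n \<in> E n) \<and> u sums x))"

definition closed_fin_codim :: "'a::real_normed_vector set \<Rightarrow> bool" where
  "closed_fin_codim Y \<longleftrightarrow> subspace Y \<and> closed Y \<and>
     (\<exists>F. finite F \<and> span (Y \<union> F) = UNIV)"

definition UALS :: "'a::banach itself \<Rightarrow> bool" where
  "UALS _ \<longleftrightarrow>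
     (\<exists>C>0. \<forall>(W :: ('a \<Rightarrow>\<^sub>L 'a) set) (A :: 'a \<Rightarrow>\<^sub>L 'a) (\<epsilon>::real).
        convex W \<and> compact W \<and> \<epsilon> > 0 \<and>
        (\<forall>x\<in>cball 0 1. \<exists>B\<in>W. norm (blinfun_apply A x - blinfun_apply B x) \<le> \<epsilon>)
        \<longrightarrow> (\<exists>Y B. closed_fin_codim Y \<and> B \<in> W \<and>
               (\<forall>y\<in>Y. norm y \<le> 1 \<longrightarrow> norm (blinfun_apply (A - B) y) \<le> C * \<epsilon>)))"

end

theory Submission
  imports Defs
begin

text \<open>By reflexivity the pairing between \<open>X\<close> and its dual is symmetric, and every operator \<open>A\<close> on one
  side is the adjoint of an operator \<open>A'\<close> on the other, so one implication suffices. A separation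
  argument turns pointwise \<open>\<epsilon>\<close>-approximation of \<open>A\<close> by \<open>W\<close> into pointwise \<open>\<epsilon>\<close>-approximation of
  \<open>A'\<close> by \<open>{B' | B \<in> W}\<close>. The UALS property then yields \<open>T = A' - B'\<close> that is small on a closed
  finite-codimensional \<open>Y\<close>. The unit ball has a finite net \<open>N\<close> modulo \<open>Y\<close>, and the
  adjoint of \<open>T\<close> is small on the common kernel of the functionals \<open>z \<mapsto> \<langle>T s, z\<rangle>\<close>, \<open>s \<in> N\<close>: a vector
  of the unit ball is a sum of a net point, a vector of \<open>Y\<close>, and an error that is absorbed.\<close>

section \<open>Sublinear functionals and the Hahn-Banach theorem\<close>

definition sublinear :: "('a::real_vector \<Rightarrow> real) \<Rightarrow> bool" where
  "sublinear q \<longleftrightarrow> (\<forall>x y. q (x + y) \<le> q x + q y) \<and> (\<forall>c\<ge>0. \<forall>x. q (c *\<^sub>R x) = c * q x)"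

lemma sublinear_add: "sublinear q \<Longrightarrow> q (x + y) \<le> q x + q y"
  and sublinear_scaleR: "sublinear q \<Longrightarrow> c \<ge> 0 \<Longrightarrow> q (c *\<^sub>R x) = c * q x"
  by (auto simp: sublinear_def)

lemma sublinear_zero: "sublinear q \<Longrightarrow> q 0 = 0"
  using sublinear_scaleR[of q 0 0] by simp

lemma sublinear_minus: "sublinear q \<Longrightarrow> - q (- x) \<le> q x"
  using sublinear_add[of q x "- x"] sublinear_zero[of q] by simp

lemma sublinear_norm: "sublinear (norm :: 'a::real_normed_vector \<Rightarrow> real)"
  by (auto simp: sublinear_def norm_triangle_ineq)

text \<open>The scaling bound for \<open>inverse c\<close> at \<open>c *\<^sub>R x\<close> gives the
  reverse inequality, so for functionals defined as infima only one direction of homogeneity has to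
  be checked.\<close>

lemma sublinearI:
  assumes add: "\<And>x y. q (x + y) \<le> q x + q y"
    and scale: "\<And>c x. c > 0 \<Longrightarrow> q (c *\<^sub>R x) \<le> c * q x"
    and zero: "q 0 = 0"
  shows "sublinear q"
  unfolding sublinear_def
proof (intro conjI allI impI add)
  fix c :: real and x assume "c \<ge> 0"
  show "q (c *\<^sub>R x) = c * q x"
  proof (cases "c = 0")
    case False
    with \<open>c \<ge> 0\<close> have c: "c > 0" by simp
    have "q (inverse c *\<^sub>R (c *\<^sub>R x)) \<le> inverse c * q (c *\<^sub>R x)"
      using c by (intro scale) simp
    then have "c * q x \<le> q (c *\<^sub>R x)"
      using c by (simp add: field_simps)
    with scale[OF c, of x] show ?thesis by simp
  qed (simp add: zero)
qed

text \<open>The witness is the infimum of \<open>p (x + t *\<^sub>R k) - t * c\<close> over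
  \<open>t \<ge> 0\<close> and \<open>k \<in> K\<close>, the largest sublinear functional below
  \<open>p\<close> with the required bound on \<open>- K\<close>. Every linear functional below it
  is at least \<open>c\<close> on \<open>K\<close>. A singleton \<open>K\<close> serves the
  Hahn-Banach theorem, a general convex \<open>K\<close> serves separation.\<close>

lemma sublinear_reduce:
  assumes p: "sublinear p" and K: "convex K" "K \<noteq> {}" and c: "\<And>k. k \<in> K \<Longrightarrow> c \<le> p k"
  shows "\<exists>q. sublinear q \<and> q \<le> p \<and> (\<forall>k\<in>K. q (- k) \<le> - c)"
proof -
  define V where "V x = {p (x + t *\<^sub>R k) - t * c | t k. t \<ge> 0 \<and> k \<in> K}" for x
  define q where "q x = Inf (V x)" for x
  \<comment> \<open>Subadditivity and \<open>c \<le> p k\<close> bound \<open>V x\<close> from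
    below, so that its infimum is meaningful.\<close>
  have V_ge: "- p (- x) \<le> v" if "v \<in> V x" for v x
  proof -
    from that obtain t k where v: "v = p (x + t *\<^sub>R k) - t * c" and t: "t \<ge> 0" and k: "k \<in> K"
      by (auto simp: V_def)
    have "t * c \<le> t * p k" using c[OF k] t by (rule mult_left_mono)
    also have "\<dots> = p ((x + t *\<^sub>R k) + - x)" using sublinear_scaleR[OF p t] by simp
    also have "\<dots> \<le> p (x + t *\<^sub>R k) + p (- x)" by (rule sublinear_add[OF p])
    finally show ?thesis using v by simp
  qed
  have bdd: "bdd_below (V x)" for x using V_ge by (intro bdd_belowI) blast
  have ne: "V x \<noteq> {}" for x using K(2) order_refl[of "0::real"] unfolding V_def by blast
  have lower: "q x \<le> p (x + t *\<^sub>R k) - t * c" if "t \<ge> 0" "k \<in> K" for x t k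
    unfolding q_def using that by (intro cInf_lower bdd) (auto simp: V_def)
  have greatest: "b \<le> q x" if "\<And>t k. t \<ge> 0 \<Longrightarrow> k \<in> K \<Longrightarrow> b \<le> p (x + t *\<^sub>R k) - t * c" for b x
    unfolding q_def using that by (intro cInf_greatest ne) (auto simp: V_def)
  obtain k0 where k0: "k0 \<in> K" using K by auto
  have le: "q x \<le> p x" for x using lower[of 0 k0 x] k0 by simp
  have "sublinear q"
  proof (rule sublinearI)
    fix x y
    have "q (x + y) - (p (y + s *\<^sub>R l) - s * c) \<le> p (x + t *\<^sub>R k) - t * c"
      if tksl: "t \<ge> 0" "k \<in> K" "s \<ge> 0" "l \<in> K" for t k s l
    proof -
      \<comment> \<open>Convexity merges the two multiples of points of \<open>K\<close> into one;
        if both coefficients vanish, any point of \<open>K\<close> will do.\<close>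
      obtain m where m: "m \<in> K" "t *\<^sub>R k + s *\<^sub>R l = (t + s) *\<^sub>R m"
      proof (cases "t + s = 0")
        case True
        then have "t = 0" "s = 0" using True tksl by linarith+
        then show ?thesis using that[of k0] k0 by simp
      next
        case False
        then have "t + s > 0" using tksl by auto
        then have "(t / (t + s)) *\<^sub>R k + (s / (t + s)) *\<^sub>R l \<in> K"
          using tksl by (intro convexD[OF K(1)]) (auto simp flip: add_divide_distrib)
        moreover have "t *\<^sub>R k + s *\<^sub>R l = (t + s) *\<^sub>R ((t / (t + s)) *\<^sub>R k + (s / (t + s)) *\<^sub>R l)"
          using False by (simp add: scaleR_add_right)
        ultimately show ?thesis using that by blast
      qed
      have "q (x + y) \<le> p ((x + y) + (t + s) *\<^sub>R m) - (t + s) * c"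
        using that m by (intro lower) auto
      also have "(x + y) + (t + s) *\<^sub>R m = (x + t *\<^sub>R k) + (y + s *\<^sub>R l)"
        by (simp flip: m(2))
      also have "p \<dots> \<le> p (x + t *\<^sub>R k) + p (y + s *\<^sub>R l)" by (rule sublinear_add[OF p])
      finally show ?thesis by (simp add: algebra_simps)
    qed
    \<comment> \<open>The infimum is taken first over \<open>t\<close> and \<open>k\<close> with
      \<open>s\<close> and \<open>l\<close> fixed, then over \<open>s\<close> and
      \<open>l\<close>.\<close>
    then have "q (x + y) - (p (y + s *\<^sub>R l) - s * c) \<le> q x" if "s \<ge> 0" "l \<in> K" for s l
      using that by (intro greatest) auto
    then have "q (x + y) - q x \<le> p (y + s *\<^sub>R l) - s * c" if "s \<ge> 0" "l \<in> K" for s l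
      using that by (smt (verit))
    then have "q (x + y) - q x \<le> q y" by (rule greatest)
    then show "q (x + y) \<le> q x + q y" by simp
  next
    fix a :: real and x assume a: "a > 0"
    have "q (a *\<^sub>R x) / a \<le> q x"
    proof (rule greatest)
      fix t k assume tk: "(t::real) \<ge> 0" "k \<in> K"
      have "q (a *\<^sub>R x) \<le> p (a *\<^sub>R x + (a * t) *\<^sub>R k) - (a * t) * c"
        using a tk by (intro lower) auto
      also have "a *\<^sub>R x + (a * t) *\<^sub>R k = a *\<^sub>R (x + t *\<^sub>R k)"
        by (simp add: scaleR_add_right)
      also have "p \<dots> = a * p (x + t *\<^sub>R k)" using a by (intro sublinear_scaleR[OF p]) simp
      finally show "q (a *\<^sub>R x) / a \<le> p (x + t *\<^sub>R k) - t * c"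
        using a by (simp add: field_simps)
    qed
    then show "q (a *\<^sub>R x) \<le> a * q x" using a by (simp add: field_simps)
  next
    have "0 \<le> q 0"
    proof (rule greatest)
      fix t k assume tk: "(t::real) \<ge> 0" "k \<in> K"
      show "0 \<le> p (0 + t *\<^sub>R k) - t * c"
        using mult_left_mono[OF c[OF tk(2)] tk(1)] sublinear_scaleR[OF p tk(1)] by simp
    qed
    then show "q 0 = 0" using le[of 0] sublinear_zero[OF p] by simp
  qed
  moreover have "q (- k) \<le> - c" if "k \<in> K" for k
    using lower[of 1 k "- k"] that sublinear_zero[OF p] by simp
  ultimately show ?thesis using le by (auto simp: le_fun_def)
qed

text \<open>The pointwise infimum works. It is finite because \<open>- q (- x)\<close> is a lower
  bound at \<open>x\<close>, and it is subadditive because of any two members of the chain the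
  smaller one lies below both.\<close>

lemma sublinear_INF_chain:
  assumes sub: "\<And>p. p \<in> C \<Longrightarrow> sublinear p" and q: "\<And>p. p \<in> C \<Longrightarrow> p \<le> q" and ne: "C \<noteq> {}"
    and chain: "\<And>p r. p \<in> C \<Longrightarrow> r \<in> C \<Longrightarrow> p \<le> r \<or> r \<le> p"
  shows "\<exists>u. sublinear u \<and> (\<forall>p\<in>C. u \<le> p)"
proof -
  define u where "u x = Inf ((\<lambda>p. p x) ` C)" for x
  have bdd: "bdd_below ((\<lambda>p. p x) ` C)" for x
  proof (rule bdd_belowI2)
    fix p assume "p \<in> C"
    then show "- q (- x) \<le> p x"
      using sublinear_minus[OF sub, of p x] q[of p] le_funD[of p q "- x"] by simp
  qed
  have lower: "u x \<le> p x" if "p \<in> C" for p x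
    unfolding u_def using that by (intro cInf_lower bdd) auto
  have greatest: "b \<le> u x" if "\<And>p. p \<in> C \<Longrightarrow> b \<le> p x" for b x
    unfolding u_def using that ne by (intro cInf_greatest) auto
  have "sublinear u"
  proof (rule sublinearI)
    fix x y
    have *: "u (x + y) - r y \<le> p x" if pr: "p \<in> C" "r \<in> C" for p r
    proof -
      obtain s where s: "s \<in> C" "s \<le> p" "s \<le> r" using chain[OF pr] pr by blast
      have "u (x + y) \<le> s x + s y"
        using lower[OF s(1), of "x + y"] sublinear_add[OF sub[OF s(1)], of x y] by simp
      then show ?thesis using s(2,3) by (smt (verit) le_fun_def)
    qed
    then have "u (x + y) - r y \<le> u x" if "r \<in> C" for r using that by (intro greatest) auto
    then have "u (x + y) - u x \<le> r y" if "r \<in> C" for r using that by (smt (verit))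
    then have "u (x + y) - u x \<le> u y" by (rule greatest)
    then show "u (x + y) \<le> u x + u y" by simp
  next
    fix a :: real and x assume a: "a > 0"
    have "u (a *\<^sub>R x) / a \<le> u x"
    proof (rule greatest)
      fix p assume "p \<in> C"
      then show "u (a *\<^sub>R x) / a \<le> p x"
        using lower[of p "a *\<^sub>R x"] sublinear_scaleR[OF sub, of p a x] a by (simp add: field_simps)
    qed
    then show "u (a *\<^sub>R x) \<le> a * u x" using a by (simp add: field_simps)
  next
    obtain p where "p \<in> C" using ne by auto
    moreover have "0 \<le> u 0" by (intro greatest) (simp add: sub sublinear_zero)
    ultimately show "u 0 = 0" using lower[of p 0] sublinear_zero[OF sub, of p] by simp
  qed
  then show ?thesis using lower by (auto simp: le_fun_def)
qed

text \<open>Zorn's lemma provides a pointwise minimal sublinear functional below \<open>q\<close>; minimality makes it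
  linear.\<close>

theorem Hahn_Banach_sublinear:
  assumes q: "sublinear q"
  shows "\<exists>f. linear f \<and> f \<le> q"
proof -
  define A where "A = {p. sublinear p \<and> p \<le> q}"
  have "\<exists>m\<in>A. \<forall>a\<in>A. a \<le> m \<longrightarrow> a = m"
  proof (rule predicate_Zorn)
    \<comment> \<open>The order is reversed, so that the maximal element supplied by Zorn's lemma is
      a minimal functional.\<close>
    show "partial_order_on A (relation_of (\<lambda>a b. b \<le> a) A)"
      by (rule partial_order_on_relation_ofI) auto
  next
    fix C assume C: "C \<in> Chains (relation_of (\<lambda>a b. b \<le> a) A)"
    then have CA: "C \<subseteq> A" by (auto simp: Chains_def relation_of_def)
    show "\<exists>u\<in>A. \<forall>a\<in>C. u \<le> a"
    proof (cases "C = {}")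
      case True
      then show ?thesis using q by (auto simp: A_def)
    next
      case False
      have "\<exists>u. sublinear u \<and> (\<forall>p\<in>C. u \<le> p)"
        using CA False C
        by (intro sublinear_INF_chain[where q = q]) (auto simp: A_def Chains_def relation_of_def)
      then obtain u where u: "sublinear u" "\<And>p. p \<in> C \<Longrightarrow> u \<le> p" by blast
      obtain p where "p \<in> C" using False by auto
      then have "u \<le> q" using u(2) CA by (force simp: A_def intro: order_trans)
      then show ?thesis using u by (auto simp: A_def)
    qed
  qed
  then obtain m where m: "sublinear m" "m \<le> q"
    and min: "\<And>a. sublinear a \<Longrightarrow> a \<le> m \<Longrightarrow> a = m"
    by (auto simp: A_def intro: order_trans)
  have neg: "m (- a) = - m a" for a
  proof -
    \<comment> \<open>Lowering \<open>m\<close> along the single vector \<open>a\<close> gives a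
      sublinear functional below \<open>m\<close>, which by minimality is \<open>m\<close> itself;
      so \<open>m\<close> is odd.\<close>
    obtain r where r: "sublinear r" "r \<le> m" "r (- a) \<le> - m a"
      using sublinear_reduce[OF m(1), of "{a}" "m a"] by auto
    then have "r = m" by (intro min)
    with r sublinear_minus[OF m(1), of a] show ?thesis by simp
  qed
  \<comment> \<open>Subadditivity at \<open>- x\<close> and \<open>- y\<close> reverses the
    inequality, since \<open>m\<close> is odd.\<close>
  have add: "m (x + y) = m x + m y" for x y
    using sublinear_add[OF m(1), of x y] sublinear_add[OF m(1), of "- x" "- y"]
      neg[of "x + y"] neg[of x] neg[of y] by simp
  have "m (c *\<^sub>R x) = c *\<^sub>R m x" for c x
  proof (cases "c \<ge> 0")
    case False
    then have "m ((- c) *\<^sub>R x) = (- c) * m x" by (intro sublinear_scaleR[OF m(1)]) simp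
    then show ?thesis by (simp add: neg)
  qed (simp add: sublinear_scaleR[OF m(1)])
  then have "linear m" using add by (intro linearI)
  then show ?thesis using m(2) by blast
qed

section \<open>Norm-one separation and norming functionals\<close>

text \<open>The norm is first reduced along \<open>K\<close> to a sublinear \<open>q\<close>, and a
  linear \<open>f\<close> is then chosen below \<open>q\<close>: \<open>q \<le> norm\<close> bounds
  the norm of \<open>f\<close>, and \<open>q (- k) \<le> - d\<close> gives the bound on
  \<open>K\<close>.\<close>

lemma convex_separation_norm:
  fixes K :: "'a::real_normed_vector set"
  assumes "convex K" "K \<noteq> {}" "\<And>k. k \<in> K \<Longrightarrow> d \<le> norm k"
  shows "\<exists>f :: 'a \<Rightarrow>\<^sub>L real. norm f \<le> 1 \<and> (\<forall>k\<in>K. d \<le> blinfun_apply f k)"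
proof -
  obtain q where q: "sublinear q" "q \<le> norm" "\<And>k. k \<in> K \<Longrightarrow> q (- k) \<le> - d"
    using sublinear_reduce[OF sublinear_norm assms] by auto
  obtain f where f: "linear f" "f \<le> q" using Hahn_Banach_sublinear[OF q(1)] by auto
  have le: "f x \<le> norm x" for x using f(2) q(2) by (auto simp: le_fun_def intro: order_trans)
  have abs: "norm (f x) \<le> norm x * 1" for x
    using le[of x] le[of "- x"] by (simp add: linear_neg[OF f(1)])
  have bl: "bounded_linear f"
    using f(1) abs by (intro bounded_linear_intro[of _ 1]) (auto simp: linear_add linear_scale)
  have "norm (Blinfun f) \<le> 1"
    using abs by (intro norm_blinfun_bound) (auto simp: bounded_linear_Blinfun_apply[OF bl])
  moreover have "d \<le> f k" if "k \<in> K" for k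
    using f(2) q(3)[OF that] by (smt (verit) le_fun_def linear_neg[OF f(1)])
  ultimately show ?thesis
    by (intro exI[of _ "Blinfun f"]) (auto simp: bounded_linear_Blinfun_apply[OF bl])
qed

lemma norming_functional:
  fixes x :: "'a::real_normed_vector"
  shows "\<exists>f :: 'a \<Rightarrow>\<^sub>L real. norm f \<le> 1 \<and> blinfun_apply f x = norm x"
proof -
  obtain f :: "'a \<Rightarrow>\<^sub>L real" where f: "norm f \<le> 1" "norm x \<le> f x"
    using convex_separation_norm[of "{x}" "norm x"] by auto
  have "f x \<le> norm f * norm x" using norm_blinfun[of f x] by simp
  also have "\<dots> \<le> 1 * norm x" using f(1) by (rule mult_right_mono) simp
  finally show ?thesis using f by (intro exI[of _ f]) simp
qed

section \<open>Closed subspaces of finite codimension\<close>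

text \<open>A ball of radius \<open>d\<close> around \<open>v\<close> misses the closed set
  \<open>Y\<close>, and scaling by \<open>t\<close> gives the estimate. It makes the coefficient of
  \<open>v\<close> depend continuously on the vector \<open>y + t *\<^sub>R v\<close>.\<close>

lemma line_coefficient_bound:
  assumes Y: "subspace Y" "closed Y" and v: "v \<notin> Y"
  shows "\<exists>d>0. \<forall>t. \<forall>y\<in>Y. d * \<bar>t\<bar> \<le> norm (y + t *\<^sub>R v)"
proof -
  have "open (- Y)" "v \<in> - Y" using Y v by auto
  then obtain d where d: "d > 0" "ball v d \<subseteq> - Y" by (auto simp: open_contains_ball)
  have "d * \<bar>t\<bar> \<le> norm (y + t *\<^sub>R v)" if y: "y \<in> Y" for t y
  proof (cases "t = 0")
    case False
    have "- (inverse t *\<^sub>R y) \<in> Y" using y Y(1) by (simp add: subspace_neg subspace_scale)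
    then have "- (inverse t *\<^sub>R y) \<notin> ball v d" using d by blast
    then have "d \<le> norm (v + inverse t *\<^sub>R y)" by (simp add: dist_norm)
    then have "d * \<bar>t\<bar> \<le> \<bar>t\<bar> * norm (v + inverse t *\<^sub>R y)"
      by (subst mult.commute) (auto intro: mult_left_mono)
    also have "\<dots> = norm (t *\<^sub>R (v + inverse t *\<^sub>R y))" by simp
    also have "t *\<^sub>R (v + inverse t *\<^sub>R y) = y + t *\<^sub>R v"
      using False by (simp add: scaleR_add_right)
    finally show ?thesis .
  qed simp
  with d(1) show ?thesis by blast
qed

lemma span_insert_subspace:
  assumes "subspace Y"
  shows "span (insert v Y) = {y + t *\<^sub>R v | y t. y \<in> Y}"
proof -
  have "span Y = Y" using assms by (simp add: span_eq_iff)
  then have "x \<in> span (insert v Y) \<longleftrightarrow> (\<exists>t. x - t *\<^sub>R v \<in> Y)" for x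
    using span_insert[of v Y] by (simp only: mem_Collect_eq)
  moreover have "(\<exists>t. x - t *\<^sub>R v \<in> Y) \<longleftrightarrow> (\<exists>y t. x = y + t *\<^sub>R v \<and> y \<in> Y)" for x
    by (metis add_diff_cancel diff_add_cancel)
  ultimately show ?thesis by blast
qed

text \<open>Along a convergent sequence the coefficients of \<open>v\<close> are Cauchy by
  \<open>line_coefficient_bound\<close>; subtracting their limit leaves a convergent sequence in the
  closed set \<open>Y\<close>.\<close>

lemma closed_span_insert:
  fixes Y :: "'a::real_normed_vector set"
  assumes Y: "subspace Y" "closed Y"
  shows "closed (span (insert v Y))"
proof (cases "v \<in> Y")
  case True
  then have "span (insert v Y) = Y" using Y(1) by (metis insert_absorb span_eq_iff)
  then show ?thesis using Y(2) by simp
next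
  case False
  obtain d where d: "d > 0" "\<And>t y. y \<in> Y \<Longrightarrow> d * \<bar>t\<bar> \<le> norm (y + t *\<^sub>R v)"
    using line_coefficient_bound[OF Y False] by blast
  show ?thesis
    unfolding closed_sequential_limits
  proof (intro allI impI, elim conjE)
    fix x l assume "\<forall>n. x n \<in> span (insert v Y)" and lim: "x \<longlonglongrightarrow> l"
    then have "\<forall>n. \<exists>y t. x n = y + t *\<^sub>R v \<and> y \<in> Y"
      by (simp add: span_insert_subspace[OF Y(1)])
    then obtain y t where x: "\<And>n. x n = y n + t n *\<^sub>R v" and y: "\<And>n. y n \<in> Y" by metis
    have "Cauchy t"
    proof (rule metric_CauchyI)
      fix e :: real assume "e > 0"
      then have "e * d > 0" using d by simp
      then obtain M where M: "\<And>m n. m \<ge> M \<Longrightarrow> n \<ge> M \<Longrightarrow> dist (x m) (x n) < e * d"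
        using LIMSEQ_imp_Cauchy[OF lim] metric_CauchyD by metis
      have "dist (t m) (t n) < e" if "m \<ge> M" "n \<ge> M" for m n
      proof -
        have "d * \<bar>t m - t n\<bar> \<le> norm ((y m - y n) + (t m - t n) *\<^sub>R v)"
          using y Y(1) by (intro d) (simp add: subspace_diff)
        also have "\<dots> = dist (x m) (x n)" by (simp add: x dist_norm algebra_simps)
        also have "\<dots> < e * d" using M that by simp
        finally show ?thesis using d by (simp add: dist_real_def mult.commute)
      qed
      then show "\<exists>M. \<forall>m\<ge>M. \<forall>n\<ge>M. dist (t m) (t n) < e" by blast
    qed
    then obtain s where s: "t \<longlonglongrightarrow> s" using Cauchy_convergent_iff convergent_def by blast
    have "(\<lambda>n. x n - t n *\<^sub>R v) \<longlonglongrightarrow> l - s *\<^sub>R v" by (intro tendsto_intros lim s)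
    then have "y \<longlonglongrightarrow> l - s *\<^sub>R v" by (simp add: x)
    then have "l - s *\<^sub>R v \<in> Y" using Y(2) y by (metis closed_sequential_limits)
    then show "l \<in> span (insert v Y)"
      by (auto simp: span_insert intro: span_base)
  qed
qed

section \<open>Finite nets of the unit ball modulo a subspace\<close>

text \<open>This is total boundedness of the unit ball of the finite-dimensional quotient by
  \<open>Y\<close>, stated without quotients. The induction moves one vector \<open>v\<close> from
  \<open>F\<close> into the subspace; a net modulo the larger subspace is refined by a net for the
  bounded range of the coefficient of \<open>v\<close>.\<close>

lemma unit_ball_net_modulo_subspace:
  fixes Y :: "'a::real_normed_vector set"
  assumes "finite F" "subspace Y" "closed Y" "span (Y \<union> F) = UNIV" "\<eta> > 0"
  shows "\<exists>S. finite S \<and> (\<forall>x\<in>cball 0 1. \<exists>s\<in>S. \<exists>y\<in>Y. norm (x - s - y) \<le> \<eta>)"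
  using assms
proof (induction F arbitrary: Y \<eta> rule: finite_induct)
  case empty
  then have "Y = UNIV" by (metis span_eq_iff sup_bot_right)
  then have "\<forall>x\<in>cball 0 1. \<exists>s\<in>{0}. \<exists>y\<in>Y. norm (x - s - y) \<le> \<eta>"
    using \<open>\<eta> > 0\<close> by (metis UNIV_I diff_0_right diff_self insertI1 less_imp_le norm_zero)
  then show ?case by blast
next
  case (insert v F)
  show ?case
  proof (cases "v \<in> Y")
    case True
    then have "span (Y \<union> F) = UNIV" using insert.prems by (simp add: insert_absorb)
    then show ?thesis using insert by blast
  next
    case False
    define Y' where "Y' = span (insert v Y)"
    obtain d where d: "d > 0" "\<And>t y. y \<in> Y \<Longrightarrow> d * \<bar>t\<bar> \<le> norm (y + t *\<^sub>R v)"
      using line_coefficient_bound[OF insert.prems(1,2) False] by blast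
    have v: "norm v > 0" using False insert.prems(1) subspace_0 by force
    have "Y \<union> insert v F \<subseteq> span (Y' \<union> F)"
      unfolding Y'_def using span_superset[of "insert v Y"]
      by (auto intro!: span_base)
    then have "span (Y' \<union> F) = UNIV"
      using insert.prems(3) span_minimal[OF _ subspace_span] by blast
    then obtain S where S: "finite S"
      "\<And>x. x \<in> cball 0 1 \<Longrightarrow> \<exists>s\<in>S. \<exists>y\<in>Y'. norm (x - s - y) \<le> \<eta> / 2"
      using insert.IH[of Y' "\<eta> / 2"] closed_span_insert[OF insert.prems(1,2), of v] insert.prems(4)
      unfolding Y'_def by auto
    obtain M where M: "\<And>s. s \<in> S \<Longrightarrow> norm s \<le> M"
      using finite_imp_bounded[OF S(1)] by (auto simp: bounded_iff)
    \<comment> \<open>A vector \<open>y'\<close> of \<open>Y'\<close> within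
      \<open>\<eta> / 2\<close> of \<open>x - s\<close> has norm at most
      \<open>1 + M + \<eta> / 2\<close>, so its coefficient of \<open>v\<close> is at most
      \<open>R\<close> in absolute value.\<close>
    define R where "R = (1 + M + \<eta> / 2) / d"
    \<comment> \<open>With this mesh, rounding the coefficient moves the vector by at most
      \<open>\<eta> / 2\<close>.\<close>
    obtain N where N: "finite N" "{- R..R} \<subseteq> (\<Union>r\<in>N. ball r (\<eta> / (2 * norm v)))"
      using compact_Icc[of "- R" R] insert.prems(4) v
      unfolding compact_eq_totally_bounded by (metis divide_pos_pos mult_pos_pos zero_less_numeral)
    define S' where "S' = (\<lambda>(s, r). s + r *\<^sub>R v) ` (S \<times> N)"
    have "\<exists>s\<in>S'. \<exists>y\<in>Y. norm (x - s - y) \<le> \<eta>" if x: "x \<in> cball 0 1" for x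
    proof -
      obtain s y' where s: "s \<in> S" "y' \<in> Y'" "norm (x - s - y') \<le> \<eta> / 2" using S(2)[OF x] by blast
      then obtain y t where y: "y \<in> Y" "y' = y + t *\<^sub>R v"
        by (auto simp: Y'_def span_insert_subspace[OF insert.prems(1)])
      have "d * \<bar>t\<bar> \<le> norm y'" using d(2)[OF y(1)] y(2) by simp
      also have "\<dots> = norm (x - s - (x - s - y'))" by simp
      also have "\<dots> \<le> norm x + norm s + norm (x - s - y')"
        using norm_triangle_ineq4[of "x - s" "x - s - y'"] norm_triangle_ineq4[of x s] by simp
      also have "\<dots> \<le> 1 + M + \<eta> / 2" using x s M by (auto intro!: add_mono)
      finally have "\<bar>t\<bar> \<le> R" using d(1) by (simp add: R_def field_simps)
      then have "t \<in> {- R..R}" by auto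
      then obtain r where r: "r \<in> N" "\<bar>r - t\<bar> < \<eta> / (2 * norm v)"
        using N(2) by (auto simp: dist_real_def)
      have "x - (s + r *\<^sub>R v) - y = (x - s - y') + (t - r) *\<^sub>R v"
        by (simp add: y(2) algebra_simps)
      then have "norm (x - (s + r *\<^sub>R v) - y) \<le> norm (x - s - y') + \<bar>t - r\<bar> * norm v"
        by (metis norm_scaleR norm_triangle_ineq)
      also have "\<dots> \<le> \<eta> / 2 + \<eta> / 2"
        using s(3) r(2) v by (intro add_mono) (auto simp: field_simps abs_minus_commute)
      finally have "norm (x - (s + r *\<^sub>R v) - y) \<le> \<eta>" by simp
      moreover have "s + r *\<^sub>R v \<in> S'" using s r by (force simp: S'_def)
      ultimately show ?thesis using y(1) by blast
    qed
    moreover have "finite S'" using S(1) N(1) by (simp add: S'_def)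
    ultimately show ?thesis by blast
  qed
qed

text \<open>Each useful net point is replaced by a vector of the unit ball close to it modulo
  \<open>Y\<close>, which doubles the error \<open>\<eta> / 2\<close>. Net points of norm at most 1
  are what the later norm estimates rely on.\<close>

lemma closed_fin_codim_unit_ball_net:
  fixes Y :: "'a::real_normed_vector set"
  assumes Y: "closed_fin_codim Y" and "\<eta> > 0"
  shows "\<exists>S. finite S \<and> S \<subseteq> cball 0 1 \<and> (\<forall>x\<in>cball 0 1. \<exists>s\<in>S. \<exists>y\<in>Y. norm (x - s - y) \<le> \<eta>)"
proof -
  obtain F where F: "finite F" "subspace Y" "closed Y" "span (Y \<union> F) = UNIV"
    using Y by (auto simp: closed_fin_codim_def)
  then have sub: "subspace Y" by simp
  obtain S where S: "finite S" "\<And>x. x \<in> cball 0 1 \<Longrightarrow> \<exists>s\<in>S. \<exists>y\<in>Y. norm (x - s - y) \<le> \<eta> / 2"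
    using unit_ball_net_modulo_subspace[OF F, of "\<eta> / 2"] \<open>\<eta> > 0\<close> by auto
  define P where "P s x \<longleftrightarrow> x \<in> cball 0 1 \<and> (\<exists>y\<in>Y. norm (x - s - y) \<le> \<eta> / 2)" for s x
  define g where "g s = (SOME x. P s x)" for s
  define S' where "S' = g ` {s \<in> S. \<exists>x. P s x}"
  have g: "P s (g s)" if "P s x" for s x unfolding g_def using that by (rule someI)
  have "\<exists>s\<in>S'. \<exists>y\<in>Y. norm (x - s - y) \<le> \<eta>" if x: "x \<in> cball 0 1" for x
  proof -
    obtain s y where s: "s \<in> S" "y \<in> Y" "norm (x - s - y) \<le> \<eta> / 2" using S(2)[OF x] by blast
    then have P: "P s x" using x by (auto simp: P_def)
    then obtain y' where y': "y' \<in> Y" "norm (g s - s - y') \<le> \<eta> / 2"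
      using g[OF P] by (auto simp: P_def)
    have "x - g s - (y - y') = (x - s - y) - (g s - s - y')" by simp
    then have "norm (x - g s - (y - y')) \<le> norm (x - s - y) + norm (g s - s - y')"
      by (metis norm_triangle_ineq4)
    then have "norm (x - g s - (y - y')) \<le> \<eta>" using s(3) y'(2) by simp
    moreover have "y - y' \<in> Y" using sub s y' by (simp add: subspace_diff)
    moreover have "g s \<in> S'" using s(1) P by (auto simp: S'_def)
    ultimately show ?thesis by blast
  qed
  moreover have "S' \<subseteq> cball 0 1" using g unfolding S'_def P_def by blast
  moreover have "finite S'" using S(1) by (simp add: S'_def)
  ultimately show ?thesis by blast
qed

section \<open>Common kernels of finitely many functionals\<close>

text \<open>If \<open>f\<close> is not zero on \<open>Y\<close>, one vector \<open>v \<in> Y\<close>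
  with \<open>f v \<noteq> 0\<close> restores what is lost: subtracting
  \<open>(f y / f v) *\<^sub>R v\<close> moves \<open>y\<close> into the kernel.\<close>

lemma closed_fin_codim_kernel:
  assumes Y: "closed_fin_codim Y" and f: "bounded_linear (f :: 'a::real_normed_vector \<Rightarrow> real)"
  shows "closed_fin_codim (Y \<inter> {x. f x = 0})"
proof -
  interpret f: bounded_linear f by fact
  obtain F where F: "finite F" "span (Y \<union> F) = UNIV" and sub: "subspace Y" and cl: "closed Y"
    using Y by (auto simp: closed_fin_codim_def)
  let ?Z = "Y \<inter> {x. f x = 0}"
  have "subspace ?Z"
    using sub by (auto simp: subspace_def f.add f.scaleR)
  moreover have "closed ?Z"
    using cl by (intro closed_Int closed_Collect_eq f.continuous_on continuous_intros)
  moreover have "\<exists>G. finite G \<and> span (?Z \<union> G) = UNIV"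
  proof (cases "Y \<subseteq> {x. f x = 0}")
    case True
    then show ?thesis using F by (auto simp: Int_absorb2)
  next
    case False
    then obtain v where v: "v \<in> Y" "f v \<noteq> 0" by auto
    have "y \<in> span (?Z \<union> insert v F)" if "y \<in> Y" for y
    proof -
      have "y - (f y / f v) *\<^sub>R v \<in> ?Z"
        using that v sub by (auto simp: f.diff f.scaleR subspace_diff subspace_scale)
      then have "y - (f y / f v) *\<^sub>R v \<in> span (?Z \<union> insert v F)" by (intro span_base) blast
      moreover have "(f y / f v) *\<^sub>R v \<in> span (?Z \<union> insert v F)"
        by (intro span_scale span_base) blast
      ultimately show ?thesis using span_add by fastforce
    qed
    then have "Y \<union> F \<subseteq> span (?Z \<union> insert v F)" by (auto intro: span_base)
    then have "span (?Z \<union> insert v F) = UNIV"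
      using F(2) span_minimal[OF _ subspace_span] by blast
    then show ?thesis using F(1) by blast
  qed
  ultimately show ?thesis by (simp add: closed_fin_codim_def)
qed

lemma closed_fin_codim_kernels:
  assumes "finite S" and "\<And>s. s \<in> S \<Longrightarrow> bounded_linear (f s :: 'a::real_normed_vector \<Rightarrow> real)"
  shows "closed_fin_codim {x. \<forall>s\<in>S. f s x = 0}"
  using assms
proof (induction S rule: finite_induct)
  case empty
  show ?case by (auto simp: closed_fin_codim_def intro!: exI[of _ "{}"])
next
  case (insert s S)
  have "{x. \<forall>s\<in>insert s S. f s x = 0} = {x. \<forall>s\<in>S. f s x = 0} \<inter> {x. f s x = 0}" by auto
  then show ?case using insert by (auto intro: closed_fin_codim_kernel)
qed

section \<open>Duality\<close>

text \<open>The assumptions say that each space is, through \<open>p\<close>, isometrically the dual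
  of the other. They are symmetric in the two spaces, so every result can also be read with the
  roles exchanged.\<close>

locale dual_pairing =
  fixes p :: "'x::banach \<Rightarrow> 'z::banach \<Rightarrow> real"
  assumes bilinear: "bounded_bilinear p"
    and bound: "\<bar>p x z\<bar> \<le> norm x * norm z"
    and norming_left: "\<exists>z. norm z \<le> 1 \<and> p x z = norm x"
    and norming_right: "\<exists>x. norm x \<le> 1 \<and> p x z = norm z"
    and represent_left: "\<exists>z. \<forall>x. blinfun_apply f x = p x z"
    and represent_right: "\<exists>x. \<forall>z. blinfun_apply g z = p x z"
begin

sublocale bounded_bilinear p by (rule bilinear)

lemma eq_leftI:
  assumes "\<And>z. p x z = p y z"
  shows "x = y"
  using norming_left[of "x - y"] assms by (auto simp: diff_left)

text \<open>For fixed \<open>x\<close> the functional \<open>p x (S z)\<close> of \<open>z\<close>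
  is represented by a vector, the value of the adjoint at \<open>x\<close>. Linearity follows from
  uniqueness of this vector, the norm bound from a norming \<open>z\<close>.\<close>

lemma adjoint_exists:
  "\<exists>T :: 'x \<Rightarrow>\<^sub>L 'x. norm T \<le> norm S \<and> (\<forall>x z. p (blinfun_apply T x) z = p x (blinfun_apply S z))"
proof -
  have bl: "bounded_linear (\<lambda>z. p x (S z))" for x
    by (rule bounded_linear_compose[OF bounded_linear_right blinfun.bounded_linear_right])
  have "\<exists>y. \<forall>z. p y z = p x (S z)" for x
    using represent_right[of "Blinfun (\<lambda>z. p x (S z))"]
    by (auto simp: bounded_linear_Blinfun_apply[OF bl])
  then obtain T where T: "\<And>x z. p (T x) z = p x (S z)" by metis
  have T_bound: "norm (T x) \<le> norm x * norm S" for x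
  proof -
    obtain z where z: "norm z \<le> 1" "p (T x) z = norm (T x)" using norming_left by blast
    have "norm (T x) = p x (S z)" using z(2) T by simp
    also have "\<dots> \<le> norm x * norm (S z)" using bound[of x "S z"] by simp
    also have "norm (S z) \<le> norm S * norm z" by (rule norm_blinfun)
    also have "\<dots> \<le> norm S" using mult_left_mono[OF z(1), of "norm S"] by simp
    finally show ?thesis by (simp add: mult_left_mono)
  qed
  have bl: "bounded_linear T"
    using T_bound by (intro bounded_linear_intro[of _ "norm S"]) (auto intro!: eq_leftI simp: T add_left scaleR_left)
  have "norm (Blinfun T) \<le> norm S"
    using T_bound by (intro norm_blinfun_bound) (auto simp: bounded_linear_Blinfun_apply[OF bl] mult.commute)
  then show ?thesis
    using T by (intro exI[of _ "Blinfun T"]) (auto simp: bounded_linear_Blinfun_apply[OF bl])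
qed

text \<open>The choice is harmless: by \<open>eq_leftI\<close> the pairing identity determines the
  operator.\<close>

definition adj :: "('z \<Rightarrow>\<^sub>L 'z) \<Rightarrow> ('x \<Rightarrow>\<^sub>L 'x)" where
  "adj S = (SOME T. norm T \<le> norm S \<and> (\<forall>x z. p (blinfun_apply T x) z = p x (blinfun_apply S z)))"

lemma norm_adj: "norm (adj S) \<le> norm S"
  and adj: "p (blinfun_apply (adj S) x) z = p x (blinfun_apply S z)"
  using someI_ex[OF adjoint_exists[of S]] by (auto simp: adj_def)

text \<open>Linearity and continuity carry convexity and compactness from \<open>W\<close> to
  \<open>adj\<close> followed by image on \<open>W\<close>.\<close>

lemma bounded_linear_adj: "bounded_linear adj"
  by (rule bounded_linear_intro[of _ 1])
    (auto intro!: blinfun_eqI eq_leftI norm_adj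
       simp: adj blinfun.add_left blinfun.scaleR_left add_left add_right scaleR_left scaleR_right)

text \<open>A minimax argument: the distance from \<open>adj A x\<close> to the convex compact set
  \<open>{adj B x | B \<in> W}\<close> is witnessed by a single functional \<open>z\<close>, at which \<open>A\<close> is approximated.\<close>

lemma adj_approximation:
  assumes W: "convex W" "compact W"
    and approx: "\<And>z. z \<in> cball 0 1 \<Longrightarrow> \<exists>B\<in>W. norm (blinfun_apply A z - blinfun_apply B z) \<le> \<epsilon>"
    and x: "x \<in> cball 0 1"
  shows "\<exists>B\<in>W. norm (blinfun_apply (adj A) x - blinfun_apply (adj B) x) \<le> \<epsilon>"
proof -
  define h where "h B = blinfun_apply (adj B) x" for B
  have h: "bounded_linear h"
    unfolding h_def
    by (rule bounded_linear_compose[OF blinfun.bounded_linear_left bounded_linear_adj])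
  define K where "K = (\<lambda>B. h A - h B) ` W"
  have "W \<noteq> {}" using approx[of 0] by auto
  have "convex K"
  proof -
    have "K = (+) (h A) ` uminus ` h ` W" by (auto simp: K_def image_image)
    moreover have "convex (h ` W)" using W(1) h by (intro convex_linear_image bounded_linear.linear)
    ultimately show ?thesis by (simp only: convex_translation convex_negations)
  qed
  have "compact K"
    unfolding K_def using W(2) h
    by (intro compact_continuous_image continuous_intros bounded_linear.continuous_on[OF h])
  \<comment> \<open>\<open>k\<close> realizes the distance from the origin to \<open>K\<close>; the
    operator sought is the one that gives \<open>k\<close>.\<close>
  then obtain k where k: "k \<in> K" "\<And>l. l \<in> K \<Longrightarrow> norm k \<le> norm l"
    using continuous_attains_inf[of K norm] \<open>W \<noteq> {}\<close> by (auto simp: K_def intro: continuous_intros)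
  obtain f :: "'x \<Rightarrow>\<^sub>L real" where f: "norm f \<le> 1" "\<And>l. l \<in> K \<Longrightarrow> norm k \<le> f l"
    using convex_separation_norm[OF \<open>convex K\<close> _ k(2)] k(1) by blast
  obtain z where z: "\<And>x. f x = p x z" using represent_left[of f] by auto
  have "norm z \<le> 1"
  proof -
    obtain y where y: "norm y \<le> 1" "p y z = norm z" using norming_right by blast
    have "norm z \<le> norm f * norm y" using norm_blinfun[of f y] y(2) z by simp
    also have "\<dots> \<le> 1" using f(1) y(1) by (simp add: mult_le_one)
    finally show ?thesis .
  qed
  \<comment> \<open>This \<open>B\<close> depends on \<open>z\<close> and need not give
    \<open>k\<close>; it only serves to bound \<open>norm k\<close>, because \<open>f\<close> is at
    least \<open>norm k\<close> on all of \<open>K\<close>.\<close>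
  then obtain B where B: "B \<in> W" "norm (A z - B z) \<le> \<epsilon>" using approx by auto
  have "norm k \<le> f (h A - h B)" using f(2) B(1) by (auto simp: K_def)
  also have "\<dots> = p x (A z - B z)" by (simp add: z h_def diff_left diff_right adj)
  also have "\<dots> \<le> norm x * norm (A z - B z)" using bound[of x "A z - B z"] by simp
  also have "\<dots> \<le> 1 * \<epsilon>" using x B(2) by (intro mult_mono) auto
  finally show ?thesis using k(1) by (auto simp: K_def h_def)
qed

text \<open>To estimate \<open>S z\<close>, it is paired with a norming \<open>x\<close>, split into
  a net point, a vector of \<open>Y\<close> and an error. The net point contributes nothing for
  \<open>z\<close> in the common kernel, and \<open>adj S\<close> is small on the vector of
  \<open>Y\<close>.\<close>

lemma small_on_fin_codim_dual:
  assumes Y: "closed_fin_codim Y"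
    and small: "\<And>y. y \<in> Y \<Longrightarrow> norm y \<le> 1 \<Longrightarrow> norm (blinfun_apply (adj S) y) \<le> \<delta>"
  shows "\<exists>Z. closed_fin_codim Z \<and> (\<forall>z\<in>Z. norm z \<le> 1 \<longrightarrow> norm (blinfun_apply S z) \<le> 5 * \<delta>)"
proof -
  have sub: "subspace Y" using Y by (simp add: closed_fin_codim_def)
  have "0 \<le> \<delta>" using small[of 0] sub by (simp add: subspace_0)
  have small': "norm (adj S y) \<le> \<delta> * norm y" if "y \<in> Y" for y
  proof (cases "y = 0")
    case False
    have "norm (adj S (inverse (norm y) *\<^sub>R y)) \<le> \<delta>"
      using that False sub by (intro small) (auto simp: subspace_scale)
    then show ?thesis using False by (simp add: blinfun.scaleR_right field_simps)
  qed simp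
  \<comment> \<open>The error \<open>1 / 2\<close> is below 1, so that its contribution can be
    absorbed into \<open>norm (S z)\<close>.\<close>
  obtain N where N: "finite N" "N \<subseteq> cball 0 1"
    "\<And>x. x \<in> cball 0 1 \<Longrightarrow> \<exists>s\<in>N. \<exists>y\<in>Y. norm (x - s - y) \<le> 1 / 2"
    using closed_fin_codim_unit_ball_net[OF Y, of "1 / 2"] by auto
  define Z where "Z = {z. \<forall>s\<in>N. p (adj S s) z = 0}"
  have "closed_fin_codim Z"
    unfolding Z_def using N(1) by (intro closed_fin_codim_kernels bounded_linear_right)
  moreover have "norm (S z) \<le> 5 * \<delta>" if z: "z \<in> Z" "norm z \<le> 1" for z
  proof -
    obtain x where x: "norm x \<le> 1" "p x (S z) = norm (S z)" using norming_right by blast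
    then obtain s y where s: "s \<in> N" "y \<in> Y" "norm (x - s - y) \<le> 1 / 2" using N(3)[of x] by auto
    have "norm y = norm (x - s - (x - s - y))" by simp
    also have "\<dots> \<le> norm x + norm s + norm (x - s - y)"
      using norm_triangle_ineq4[of "x - s" "x - s - y"] norm_triangle_ineq4[of x s] by simp
    also have "\<dots> \<le> 1 + 1 + 1 / 2" using x s N(2) by (intro add_mono) auto
    finally have y: "norm y \<le> 5 / 2" by simp
    have "norm (S z) = p s (S z) + p y (S z) + p (x - s - y) (S z)"
      by (simp add: diff_left x(2))
    also have "p s (S z) = 0" using z(1) s(1) by (simp add: Z_def adj)
    also have "p y (S z) \<le> 5 / 2 * \<delta>"
    proof -
      have "p y (S z) \<le> norm (adj S y) * norm z" using bound[of "adj S y" z] by (simp add: adj)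
      also have "\<dots> \<le> norm (adj S y) * 1" using z(2) by (intro mult_left_mono) auto
      also have "\<dots> \<le> \<delta> * norm y" using small'[OF s(2)] by simp
      also have "\<dots> \<le> \<delta> * (5 / 2)" using y \<open>0 \<le> \<delta>\<close> by (intro mult_left_mono)
      finally show ?thesis by simp
    qed
    \<comment> \<open>Half of \<open>norm (S z)\<close> moves to the left-hand side, which doubles
      \<open>5 / 2 * \<delta>\<close> to \<open>5 * \<delta>\<close>.\<close>
    also have "p (x - s - y) (S z) \<le> 1 / 2 * norm (S z)"
      using bound[of "x - s - y" "S z"] mult_right_mono[OF s(3), of "norm (S z)"] by simp
    finally show ?thesis by simp
  qed
  ultimately show ?thesis by blast
qed

text \<open>The property of \<open>'x\<close> is applied to \<open>adj A\<close> and the image of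
  \<open>W\<close> under \<open>adj\<close>. Passing back costs the factor 5, so
  \<open>5 * C\<close> is a uniform constant for \<open>'z\<close>.\<close>

lemma UALS_dual:
  assumes "UALS TYPE('x)"
  shows "UALS TYPE('z)"
proof -
  obtain C where C: "C > 0" "\<forall>W (A :: 'x \<Rightarrow>\<^sub>L 'x) \<epsilon>. convex W \<and> compact W \<and> \<epsilon> > 0 \<and>
        (\<forall>x\<in>cball 0 1. \<exists>B\<in>W. norm (blinfun_apply A x - blinfun_apply B x) \<le> \<epsilon>) \<longrightarrow>
        (\<exists>Y B. closed_fin_codim Y \<and> B \<in> W \<and>
          (\<forall>y\<in>Y. norm y \<le> 1 \<longrightarrow> norm (blinfun_apply (A - B) y) \<le> C * \<epsilon>))"
    using assms unfolding UALS_def by (elim exE conjE) (rule that)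
  have "\<exists>Z B. closed_fin_codim Z \<and> B \<in> W \<and>
      (\<forall>z\<in>Z. norm z \<le> 1 \<longrightarrow> norm (blinfun_apply (A - B) z) \<le> 5 * C * \<epsilon>)"
    if W: "convex W" "compact W" and \<epsilon>: "\<epsilon> > 0"
      and approx: "\<forall>z\<in>cball 0 1. \<exists>B\<in>W. norm (blinfun_apply A z - blinfun_apply B z) \<le> \<epsilon>"
    for W and A :: "'z \<Rightarrow>\<^sub>L 'z" and \<epsilon>
  proof -
    have "convex (adj ` W)"
      using W(1) bounded_linear_adj by (intro convex_linear_image bounded_linear.linear)
    moreover have "compact (adj ` W)"
      using compact_continuous_image[OF _ W(2)]
        bounded_linear.continuous_on[OF bounded_linear_adj continuous_on_id] by blast
    moreover have "\<forall>x\<in>cball 0 1. \<exists>B\<in>adj ` W. norm (adj A x - blinfun_apply B x) \<le> \<epsilon>"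
      using adj_approximation[OF W] approx by blast
    ultimately have "\<exists>Y B. closed_fin_codim Y \<and> B \<in> adj ` W \<and>
        (\<forall>y\<in>Y. norm y \<le> 1 \<longrightarrow> norm (blinfun_apply (adj A - B) y) \<le> C * \<epsilon>)"
      using \<epsilon> by (intro C(2)[THEN spec, THEN spec, THEN spec, THEN mp] conjI)
    then obtain Y B where Y: "closed_fin_codim Y" and B: "B \<in> W"
      and small: "\<forall>y\<in>Y. norm y \<le> 1 \<longrightarrow> norm (blinfun_apply (adj A - adj B) y) \<le> C * \<epsilon>"
      by (elim exE conjE imageE) (simp only:)
    have "adj A - adj B = adj (A - B)"
      using bounded_linear.linear[OF bounded_linear_adj] by (simp add: linear_diff)
    then obtain Z where "closed_fin_codim Z"
      "\<forall>z\<in>Z. norm z \<le> 1 \<longrightarrow> norm (blinfun_apply (A - B) z) \<le> 5 * (C * \<epsilon>)"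
      using small_on_fin_codim_dual[OF Y, of "A - B" "C * \<epsilon>"] small by auto
    then show ?thesis using B by (auto simp: mult.assoc)
  qed
  then show ?thesis
    unfolding UALS_def using C(1) by (intro exI[of _ "5 * C"]) auto
qed

end

section \<open>The evaluation pairing of a reflexive space\<close>

lemma dual_pairing_swap: "dual_pairing p \<Longrightarrow> dual_pairing (\<lambda>z x. p x z)"
  unfolding dual_pairing_def using bounded_bilinear.flip[of p] by (simp add: mult.commute)

text \<open>Reflexivity enters on the right: it represents functionals on the dual by vectors and
  makes every functional attain its norm on the unit ball.\<close>

lemma dual_pairing_reflexive:
  assumes "reflexive_space TYPE('a::banach)"
  shows "dual_pairing (\<lambda>(x::'a) f. blinfun_apply f x)"
proof (rule dual_pairing.intro)
  show "bounded_bilinear (\<lambda>(x::'a) (f :: 'a \<Rightarrow>\<^sub>L real). blinfun_apply f x)"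
    by (rule bounded_bilinear.flip[OF bounded_bilinear_blinfun_apply])
  show "\<bar>blinfun_apply f x\<bar> \<le> norm x * norm f" for x :: 'a and f :: "'a \<Rightarrow>\<^sub>L real"
    using norm_blinfun[of f x] by (simp add: mult.commute)
  show "\<exists>f :: 'a \<Rightarrow>\<^sub>L real. norm f \<le> 1 \<and> blinfun_apply f x = norm x" for x
    by (rule norming_functional)
  show "\<exists>x :: 'a. norm x \<le> 1 \<and> blinfun_apply f x = norm f" for f :: "'a \<Rightarrow>\<^sub>L real"
  proof -
    obtain \<phi> :: "('a \<Rightarrow>\<^sub>L real) \<Rightarrow>\<^sub>L real" where \<phi>: "norm \<phi> \<le> 1" "\<phi> f = norm f"
      using norming_functional by blast
    obtain x where x: "\<And>g. \<phi> g = blinfun_apply g x"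
      using assms by (auto simp: reflexive_space_def)
    \<comment> \<open>A functional norming \<open>x\<close> shows that the vector representing
      \<open>\<phi>\<close> stays in the unit ball.\<close>
    obtain g :: "'a \<Rightarrow>\<^sub>L real" where g: "norm g \<le> 1" "g x = norm x" using norming_functional by blast
    have "norm x \<le> norm \<phi> * norm g" using norm_blinfun[of \<phi> g] x g(2) by simp
    also have "\<dots> \<le> 1" using \<phi>(1) g(1) by (simp add: mult_le_one)
    finally show ?thesis using \<phi>(2) x by auto
  qed
  show "\<exists>z. \<forall>x. blinfun_apply f x = blinfun_apply z x" for f :: "'a \<Rightarrow>\<^sub>L real" by blast
  show "\<exists>x. \<forall>f. blinfun_apply \<phi> f = blinfun_apply f x" for \<phi> :: "('a \<Rightarrow>\<^sub>L real) \<Rightarrow>\<^sub>L real"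
    using assms by (auto simp: reflexive_space_def)
qed

theorem theorem5p22:
  assumes "reflexive_space TYPE('a::banach)"
    and "has_FDD TYPE('a)"
  shows "UALS TYPE('a) \<longleftrightarrow> UALS TYPE('a \<Rightarrow>\<^sub>L real)"
  \<comment> \<open>The pairing gives the passage from the space to its dual, the swapped pairing
    the converse.\<close>
  using dual_pairing.UALS_dual[OF dual_pairing_reflexive[OF assms(1)]]
    dual_pairing.UALS_dual[OF dual_pairing_swap[OF dual_pairing_reflexive[OF assms(1)]]]
  by blast

end
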